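(* Let $S_1,S_2$ be finite sets, $k_1,k_2\in\mathbb{R}_+$, let $\varphi_1\colon 2^{S_1}\to\mathbb{R}_+$ be a $k_1$-polymatroid function and $\varphi_2\colon 2^{S_2}\to\mathbb{R}_+$ be a $k_2$-polymatroid function. Then $\varphi_1$ and $\varphi_2$ have a coupling $\varphi\colon 2^{S_1\times S_2}\to\mathbb{R}_+$ which is a $(k_1\cdot k_2)$-polymatroid function, and which can be chosen integer-valued if $\varphi_1$ and $\varphi_2$ are integer-valued.
   Context: A polymatroid function on a finite set $S$ is a function $\varphi\colon 2^S\to\mathbb{R}_+$ that is increasing ($X\subseteq Y\Rightarrow\varphi(X)\le\varphi(Y)$), submodular ($\varphi(X)+\varphi(Y)\ge\varphi(X\cap Y)+\varphi(X\cup Y)$) and satisfies $\varphi(\emptyset)=0$; it is a $k$-polymatroid function if moreover $\varphi(X)\le k\cdot|X|$ for all $X\subseteq S$. A function $\varphi\colon 2^{S_1\times S_2}\to\mathbb{R}$ is a coupling of $\varphi_1$ and $\varphi_2$ if $\varphi(X_1\times S_2)=\varphi_1(X_1)\varphi_2(S_2)$ for every $X_1\subseteq S_1$ and $\varphi(S_1\times X_2)=\varphi_1(S_1)\varphi_2(X_2)$ for every $X_2\subseteq S_2$. *)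

theory Defs
  imports Complex_Main
begin

text \<open>A set function on \<open>2\<^sup>S\<close> is a total HOL function on \<open>'a set\<close>; only its values on
  subsets of \<open>S\<close> are ever constrained.\<close>

definition polymatroid_function :: "'a set \<Rightarrow> ('a set \<Rightarrow> real) \<Rightarrow> bool" where
  "polymatroid_function S \<phi> \<longleftrightarrow>
     finite S \<and>
     (\<forall>X. X \<subseteq> S \<longrightarrow> 0 \<le> \<phi> X) \<and>
     (\<forall>X Y. X \<subseteq> Y \<and> Y \<subseteq> S \<longrightarrow> \<phi> X \<le> \<phi> Y) \<and>
     (\<forall>X Y. X \<subseteq> S \<and> Y \<subseteq> S \<longrightarrow> \<phi> X + \<phi> Y \<ge> \<phi> (X \<inter> Y) + \<phi> (X \<union> Y)) \<and>
     \<phi> {} = 0"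

definition k_polymatroid_function :: "real \<Rightarrow> 'a set \<Rightarrow> ('a set \<Rightarrow> real) \<Rightarrow> bool" where
  "k_polymatroid_function k S \<phi> \<longleftrightarrow>
     polymatroid_function S \<phi> \<and> (\<forall>X. X \<subseteq> S \<longrightarrow> \<phi> X \<le> k * real (card X))"

definition is_coupling ::
  "'a set \<Rightarrow> 'b set \<Rightarrow> ('a set \<Rightarrow> real) \<Rightarrow> ('b set \<Rightarrow> real) \<Rightarrow> (('a \<times> 'b) set \<Rightarrow> real) \<Rightarrow> bool" where
  "is_coupling S1 S2 \<phi>1 \<phi>2 \<phi> \<longleftrightarrow>
     (\<forall>X1. X1 \<subseteq> S1 \<longrightarrow> \<phi> (X1 \<times> S2) = \<phi>1 X1 * \<phi>2 S2) \<and>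
     (\<forall>X2. X2 \<subseteq> S2 \<longrightarrow> \<phi> (S1 \<times> X2) = \<phi>1 S1 * \<phi>2 X2)"

definition integer_valued_on :: "'a set \<Rightarrow> ('a set \<Rightarrow> real) \<Rightarrow> bool" where
  "integer_valued_on S \<phi> \<longleftrightarrow> (\<forall>X. X \<subseteq> S \<longrightarrow> \<phi> X \<in> \<int>)"

end

theory Submission
  imports Defs
begin

text \<open>
  Choose modular functions \<open>a \<le> \<phi>1\<close> and \<open>b \<le> \<phi>2\<close> that are nonnegative and tight on the ground sets
  (vertices of the base polytopes, found by the greedy algorithm). Writing \<open>Z\<^sup>y\<close> and \<open>Z\<^sub>x\<close> for the
  sections of \<open>Z\<close>, the function
  \<open>\<psi>(Z) = \<Sum>y. b(y) \<phi>1(Z\<^sup>y) + \<Sum>x. a(x) \<phi>2(Z\<^sub>x) - \<Sum>(x,y)\<in>Z. a(x) b(y)\<close>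
  is submodular and has the right marginals, but need not be increasing. It dominates each of its
  first two sums, since \<open>b \<le> \<phi>2\<close> and \<open>a \<le> \<phi>1\<close>. Hence its convolution
  \<open>X \<mapsto> min\<^sub>Z (\<psi>(Z) + c(X - Z))\<close> with the modular function \<open>c(x,y) = \<phi>1({x}) \<phi>2({y})\<close>, which is
  increasing, submodular and at most \<open>c(X) \<le> k1 k2 |X|\<close>, still has the right marginals. Using \<open>c\<close>
  rather than \<open>k1 k2\<close> times cardinality keeps the values integral when \<open>k1\<close>, \<open>k2\<close> are not integers.
\<close>

section \<open>Polymatroid functions and their greedy base vectors\<close>

lemma
  assumes "polymatroid_function S f"
  shows polymatroid_function_finite: "finite S"
    and polymatroid_function_nonneg: "X \<subseteq> S \<Longrightarrow> 0 \<le> f X"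
    and polymatroid_function_mono: "X \<subseteq> Y \<Longrightarrow> Y \<subseteq> S \<Longrightarrow> f X \<le> f Y"
    and polymatroid_function_submodular:
      "X \<subseteq> S \<Longrightarrow> Y \<subseteq> S \<Longrightarrow> f (X \<inter> Y) + f (X \<union> Y) \<le> f X + f Y"
    and polymatroid_function_empty: "f {} = 0"
  using assms by (simp_all add: polymatroid_function_def)

lemma polymatroid_function_subset:
  assumes "polymatroid_function S f" "T \<subseteq> S"
  shows "polymatroid_function T f"
proof -
  note f = assms(1)
  have T: "X \<subseteq> S" if "X \<subseteq> T" for X using that assms(2) by (rule subset_trans)
  show ?thesis
    unfolding polymatroid_function_def
    using finite_subset[OF assms(2) polymatroid_function_finite[OF f]]
      polymatroid_function_nonneg[OF f T] polymatroid_function_mono[OF f _ T]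
      polymatroid_function_submodular[OF f T T] polymatroid_function_empty[OF f]
    by simp
qed

text \<open>Greedy algorithm: the elements are added one at a time and each receives the increase of
  \<open>f\<close> it causes. These increases telescope to \<open>f S\<close>, are nonnegative by
  monotonicity, and are integers as differences of values of \<open>f\<close>.\<close>

lemma polymatroid_function_base:
  fixes f :: "'a set \<Rightarrow> real"
  assumes "finite S" "polymatroid_function S f"
  obtains a where "\<And>x. x \<in> S \<Longrightarrow> 0 \<le> a x" "sum a S = f S"
    "\<And>X. X \<subseteq> S \<Longrightarrow> sum a X \<le> f X"
    "integer_valued_on S f \<Longrightarrow> \<forall>x\<in>S. a x \<in> \<int>"
proof -
  have "\<exists>a. (\<forall>x\<in>S. 0 \<le> a x) \<and> sum a S = f S \<and> (\<forall>X. X \<subseteq> S \<longrightarrow> sum a X \<le> f X) \<and>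
      (integer_valued_on S f \<longrightarrow> (\<forall>x\<in>S. a x \<in> \<int>))"
    using assms
  proof (induction S rule: finite_induct)
    case empty
    then show ?case by (auto simp: polymatroid_function_def)
  next
    case (insert x F)
    have "polymatroid_function F f"
      by (rule polymatroid_function_subset[OF insert.prems]) auto
    with insert.IH obtain a where a: "\<forall>x\<in>F. 0 \<le> a x" "sum a F = f F"
      "\<forall>X. X \<subseteq> F \<longrightarrow> sum a X \<le> f X" "integer_valued_on F f \<longrightarrow> (\<forall>x\<in>F. a x \<in> \<int>)"
      by blast
    define a' where "a' = a(x := f (insert x F) - f F)"
    have a'_F: "sum a' X = sum a X" if "X \<subseteq> F" for X
      using that insert.hyps unfolding a'_def by (intro sum.cong) auto
    have mono: "f F \<le> f (insert x F)"
      by (rule polymatroid_function_mono[OF insert.prems]) auto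
    have "sum a' X \<le> f X" if X: "X \<subseteq> insert x F" for X
    proof (cases "x \<in> X")
      case True
      let ?Y = "X - {x}"
      have Y: "?Y \<subseteq> F" using X by auto
      have "X \<inter> F = ?Y" "X \<union> F = insert x F" using X True insert.hyps by auto
      \<comment> \<open>Diminishing returns: the increase caused by \<open>x\<close> over all of
        \<open>F\<close> is at most its increase over the smaller set
        \<open>X - {x}\<close>.\<close>
      moreover have "f (X \<inter> F) + f (X \<union> F) \<le> f X + f F"
        by (rule polymatroid_function_submodular[OF insert.prems X]) auto
      moreover have "sum a' X = a' x + sum a' ?Y"
        using True X insert.hyps by (intro sum.remove) (auto intro: finite_subset)
      moreover have "sum a' ?Y \<le> f ?Y" using a'_F[OF Y] a(3) Y by auto
      ultimately show ?thesis by (simp add: a'_def)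
    next
      case False
      then have "X \<subseteq> F" using X by auto
      then show ?thesis using a'_F a(3) by auto
    qed
    moreover have "sum a' (insert x F) = f (insert x F)"
      using insert.hyps a'_F[of F] a(2) by (simp add: a'_def)
    moreover have "\<forall>y\<in>insert x F. 0 \<le> a' y" using a(1) mono by (auto simp: a'_def)
    moreover have "\<forall>y\<in>insert x F. a' y \<in> \<int>" if int: "integer_valued_on (insert x F) f"
    proof -
      have "integer_valued_on F f" "f (insert x F) \<in> \<int>" "f F \<in> \<int>"
        using int unfolding integer_valued_on_def by blast+
      then show ?thesis using a(4) by (auto simp: a'_def)
    qed
    ultimately show ?case by blast
  qed
  then show ?thesis using that by blast
qed

text \<open>Adding the elements of \<open>X - Z\<close> to \<open>Z\<close> one by one raises
  \<open>f\<close> by at most \<open>f {x}\<close> each, by submodularity, and the resulting set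
  contains \<open>X\<close>.\<close>

lemma polymatroid_function_le_add_singletons:
  assumes f: "polymatroid_function S f" and X: "X \<subseteq> S" and Z: "Z \<subseteq> S"
  shows "f X \<le> f Z + (\<Sum>x\<in>X - Z. f {x})"
proof -
  have "f (Z \<union> D) \<le> f Z + (\<Sum>x\<in>D. f {x})" if "finite D" "D \<subseteq> S" for D
    using that
  proof (induction D rule: finite_induct)
    case (insert x D)
    have "f ((Z \<union> D) \<inter> {x}) + f ((Z \<union> D) \<union> {x}) \<le> f (Z \<union> D) + f {x}"
      by (rule polymatroid_function_submodular[OF f]) (use Z insert.prems in auto)
    \<comment> \<open>The intersection may be \<open>{x}\<close>, since \<open>x\<close> may lie in
      \<open>Z\<close>; nonnegativity covers both cases.\<close>
    moreover have "0 \<le> f ((Z \<union> D) \<inter> {x})"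
      by (rule polymatroid_function_nonneg[OF f]) (use Z insert.prems in auto)
    moreover have "(Z \<union> D) \<union> {x} = Z \<union> insert x D" by auto
    ultimately show ?case using insert by auto
  qed simp
  moreover have "finite (X - Z)" "X - Z \<subseteq> S"
    using X polymatroid_function_finite[OF f] by (auto intro: finite_subset)
  moreover have "f X \<le> f (Z \<union> (X - Z))"
    by (rule polymatroid_function_mono[OF f]) (use X Z in auto)
  ultimately show ?thesis by fastforce
qed

section \<open>Weighted sums over sections\<close>

text \<open>The previous bound is scaled by \<open>w t\<close>, and the weight of its singleton
  terms is then raised to \<open>d t\<close>. With a base vector as \<open>w\<close> and singleton
  values as \<open>d\<close>, the last sum is the cost \<open>c\<close> of the part of a full-width
  rectangle outside \<open>Z\<close>.\<close>

lemma weighted_sections_lower_bound: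
  assumes f: "polymatroid_function S f" and X: "X \<subseteq> S" and Z: "\<And>t. t \<in> T \<Longrightarrow> Z t \<subseteq> S"
    and w: "\<And>t. t \<in> T \<Longrightarrow> 0 \<le> w t" "\<And>t. t \<in> T \<Longrightarrow> w t \<le> d t"
  shows "f X * sum w T \<le> (\<Sum>t\<in>T. w t * f (Z t)) + (\<Sum>t\<in>T. \<Sum>x\<in>X - Z t. f {x} * d t)"
proof -
  have "w t * f X \<le> w t * f (Z t) + (\<Sum>x\<in>X - Z t. f {x} * d t)" if t: "t \<in> T" for t
  proof -
    have "0 \<le> (\<Sum>x\<in>X - Z t. f {x})"
      using X by (intro sum_nonneg polymatroid_function_nonneg[OF f]) auto
    then have "w t * (\<Sum>x\<in>X - Z t. f {x}) \<le> d t * (\<Sum>x\<in>X - Z t. f {x})"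
      using w t by (intro mult_right_mono) auto
    moreover have "w t * f X \<le> w t * (f (Z t) + (\<Sum>x\<in>X - Z t. f {x}))"
      using polymatroid_function_le_add_singletons[OF f X Z[OF t]] w t
      by (intro mult_left_mono) auto
    ultimately show ?thesis
      by (simp add: distrib_left flip: sum_distrib_right) (simp add: mult.commute)
  qed
  then show ?thesis
    by (simp add: sum_distrib_left mult.commute[of "f X"] flip: sum.distrib) (rule sum_mono)
qed

lemma sum_Image:
  assumes "finite A" "finite B" "D \<subseteq> A \<times> B"
  shows "sum g D = (\<Sum>x\<in>A. \<Sum>y\<in>D `` {x}. g (x, y))"
proof -
  have "D = Sigma A (\<lambda>x. D `` {x})" using assms(3) by auto
  moreover have "finite (D `` {x})" for x
    using assms by (intro finite_subset[of "D `` {x}" B]) auto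
  ultimately show ?thesis using assms(1) by (simp add: sum.Sigma)
qed

lemma sum_converse_Image:
  assumes "finite A" "finite B" "D \<subseteq> A \<times> B"
  shows "sum g D = (\<Sum>y\<in>B. \<Sum>x\<in>D\<inverse> `` {y}. g (x, y))"
proof -
  have "sum g D = sum (\<lambda>(y, x). g (x, y)) (D\<inverse>)"
    by (rule sum.reindex_bij_witness[of _ prod.swap prod.swap]) auto
  also have "\<dots> = (\<Sum>y\<in>B. \<Sum>x\<in>D\<inverse> `` {y}. g (x, y))"
    using assms by (subst sum_Image[of B A]) auto
  finally show ?thesis .
qed

lemma weighted_sections_submodular:
  assumes f: "polymatroid_function S f" and w: "\<And>t. t \<in> T \<Longrightarrow> 0 \<le> w t"
    and Z: "\<And>t. t \<in> T \<Longrightarrow> Z t \<subseteq> S" and W: "\<And>t. t \<in> T \<Longrightarrow> W t \<subseteq> S"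
  shows "(\<Sum>t\<in>T. w t * f (Z t \<inter> W t)) + (\<Sum>t\<in>T. w t * f (Z t \<union> W t))
    \<le> (\<Sum>t\<in>T. w t * f (Z t)) + (\<Sum>t\<in>T. w t * f (W t))"
proof -
  have "w t * (f (Z t \<inter> W t) + f (Z t \<union> W t)) \<le> w t * (f (Z t) + f (W t))" if "t \<in> T" for t
    using that by (intro mult_left_mono polymatroid_function_submodular[OF f] Z W w)
  then show ?thesis by (simp add: distrib_left flip: sum.distrib) (rule sum_mono)
qed

section \<open>Convolution with a modular function\<close>

text \<open>\<open>Z\<close> ranges over all subsets of \<open>E\<close>, not only over those of
  \<open>X\<close>: this makes the result increasing for nonnegative \<open>c\<close> even when
  \<open>\<psi>\<close> is not.\<close>

definition modular_convolution ::
  "'a set \<Rightarrow> ('a set \<Rightarrow> real) \<Rightarrow> ('a \<Rightarrow> real) \<Rightarrow> 'a set \<Rightarrow> real" where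
  "modular_convolution E \<psi> c X = (MIN Z \<in> Pow E. \<psi> Z + sum c (X - Z))"

context
  fixes E :: "'a set" and \<psi> :: "'a set \<Rightarrow> real" and c :: "'a \<Rightarrow> real"
  assumes finite_E: "finite E"
begin

lemma modular_convolution_le: "Z \<subseteq> E \<Longrightarrow> modular_convolution E \<psi> c X \<le> \<psi> Z + sum c (X - Z)"
  unfolding modular_convolution_def using finite_E by (intro Min_le) auto

lemma modular_convolution_attained:
  obtains Z where "Z \<subseteq> E" "modular_convolution E \<psi> c X = \<psi> Z + sum c (X - Z)"
proof -
  have "modular_convolution E \<psi> c X \<in> (\<lambda>Z. \<psi> Z + sum c (X - Z)) ` Pow E"
    unfolding modular_convolution_def using finite_E by (intro Min_in) auto
  then show ?thesis using that by auto
qed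

lemma modular_convolution_eqI:
  assumes "X \<subseteq> E" "\<And>Z. Z \<subseteq> E \<Longrightarrow> \<psi> X \<le> \<psi> Z + sum c (X - Z)"
  shows "modular_convolution E \<psi> c X = \<psi> X"
proof -
  obtain Z where "Z \<subseteq> E" "modular_convolution E \<psi> c X = \<psi> Z + sum c (X - Z)"
    by (rule modular_convolution_attained)
  then show ?thesis using modular_convolution_le[OF assms(1), of X] assms(2)[of Z] by simp
qed

lemma modular_convolution_polymatroid_function:
  assumes c: "\<And>e. e \<in> E \<Longrightarrow> 0 \<le> c e"
    and empty: "\<psi> {} = 0" and nonneg: "\<And>Z. Z \<subseteq> E \<Longrightarrow> 0 \<le> \<psi> Z"
    and submod: "\<And>Z W. Z \<subseteq> E \<Longrightarrow> W \<subseteq> E \<Longrightarrow> \<psi> (Z \<inter> W) + \<psi> (Z \<union> W) \<le> \<psi> Z + \<psi> W"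
  shows "polymatroid_function E (modular_convolution E \<psi> c)"
  unfolding polymatroid_function_def
proof (intro conjI allI impI; (elim conjE)?)
  let ?\<phi> = "modular_convolution E \<psi> c"
  show "finite E" by (rule finite_E)
  show nonneg': "0 \<le> ?\<phi> X" if "X \<subseteq> E" for X
  proof -
    obtain Z where "Z \<subseteq> E" "?\<phi> X = \<psi> Z + sum c (X - Z)" by (rule modular_convolution_attained)
    moreover have "0 \<le> sum c (X - Z)" using c that by (intro sum_nonneg) auto
    ultimately show ?thesis using nonneg[of Z] by simp
  qed
  show "?\<phi> {} = 0" using modular_convolution_le[of "{}" "{}"] nonneg'[of "{}"] empty by simp
  show "?\<phi> X \<le> ?\<phi> Y" if "X \<subseteq> Y" "Y \<subseteq> E" for X Y
  proof -
    \<comment> \<open>A minimizer for \<open>Y\<close> is also a candidate for \<open>X\<close>,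
      where it costs no more.\<close>
    obtain Z where Z: "Z \<subseteq> E" "?\<phi> Y = \<psi> Z + sum c (Y - Z)" by (rule modular_convolution_attained)
    have "sum c (X - Z) \<le> sum c (Y - Z)"
      using that c finite_E by (intro sum_mono2) (auto intro: finite_subset)
    then show ?thesis using modular_convolution_le[OF Z(1), of X] Z(2) by simp
  qed
  show "?\<phi> X + ?\<phi> Y \<ge> ?\<phi> (X \<inter> Y) + ?\<phi> (X \<union> Y)" if XY: "X \<subseteq> E" "Y \<subseteq> E" for X Y
  proof -
    obtain Z where Z: "Z \<subseteq> E" "?\<phi> X = \<psi> Z + sum c (X - Z)" by (rule modular_convolution_attained)
    obtain W where W: "W \<subseteq> E" "?\<phi> Y = \<psi> W + sum c (Y - W)" by (rule modular_convolution_attained)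
    \<comment> \<open>Writing all four sums over the common index set \<open>E\<close> reduces the
      next inequality to a check for each single element.\<close>
    have indicator: "sum c A = (\<Sum>e\<in>E. if e \<in> A then c e else 0)" if "A \<subseteq> E" for A
      using that finite_E by (simp add: sum.If_cases Int_absorb1 Int_def[symmetric])
    have "sum c (X \<inter> Y - Z \<inter> W) + sum c (X \<union> Y - (Z \<union> W)) \<le> sum c (X - Z) + sum c (Y - W)"
    proof -
      have sub: "X \<inter> Y - Z \<inter> W \<subseteq> E" "X \<union> Y - (Z \<union> W) \<subseteq> E" "X - Z \<subseteq> E" "Y - W \<subseteq> E"
        using XY by auto
      show ?thesis
        unfolding sub[THEN indicator] sum.distrib[symmetric] using c by (intro sum_mono) simp
    qed
    \<comment> \<open>The meet and the join of the two minimizers serve as candidates for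
      \<open>X \<inter> Y\<close> and \<open>X \<union> Y\<close>.\<close>
    moreover have "?\<phi> (X \<inter> Y) \<le> \<psi> (Z \<inter> W) + sum c (X \<inter> Y - Z \<inter> W)"
      using Z(1) by (intro modular_convolution_le) auto
    moreover have "?\<phi> (X \<union> Y) \<le> \<psi> (Z \<union> W) + sum c (X \<union> Y - (Z \<union> W))"
      using Z(1) W(1) by (intro modular_convolution_le) auto
    ultimately show ?thesis using submod[OF Z(1) W(1)] Z(2) W(2) by linarith
  qed
qed

end

section \<open>Construction of the coupling\<close>

theorem theorem3p2:
  fixes S1 :: "'a set" and S2 :: "'b set"
    and k1 k2 :: real
    and \<phi>1 :: "'a set \<Rightarrow> real" and \<phi>2 :: "'b set \<Rightarrow> real"
  assumes "finite S1" and "finite S2"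
    and "0 \<le> k1" and "0 \<le> k2"
    and "k_polymatroid_function k1 S1 \<phi>1"
    and "k_polymatroid_function k2 S2 \<phi>2"
  shows "\<exists>\<phi> :: ('a \<times> 'b) set \<Rightarrow> real.
           is_coupling S1 S2 \<phi>1 \<phi>2 \<phi> \<and>
           k_polymatroid_function (k1 * k2) (S1 \<times> S2) \<phi> \<and>
           (integer_valued_on S1 \<phi>1 \<and> integer_valued_on S2 \<phi>2 \<longrightarrow>
              integer_valued_on (S1 \<times> S2) \<phi>)"
proof -
  have f1: "polymatroid_function S1 \<phi>1" and f2: "polymatroid_function S2 \<phi>2"
    and le1: "\<And>X. X \<subseteq> S1 \<Longrightarrow> \<phi>1 X \<le> k1 * real (card X)"
    and le2: "\<And>X. X \<subseteq> S2 \<Longrightarrow> \<phi>2 X \<le> k2 * real (card X)"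
    using assms unfolding k_polymatroid_function_def by auto
  note nonneg1 = polymatroid_function_nonneg[OF f1]
  note nonneg2 = polymatroid_function_nonneg[OF f2]
  note empty = polymatroid_function_empty[OF f1] polymatroid_function_empty[OF f2]
  obtain a where a: "\<And>x. x \<in> S1 \<Longrightarrow> 0 \<le> a x" "sum a S1 = \<phi>1 S1"
    "\<And>X. X \<subseteq> S1 \<Longrightarrow> sum a X \<le> \<phi>1 X" "integer_valued_on S1 \<phi>1 \<Longrightarrow> \<forall>x\<in>S1. a x \<in> \<int>"
    using polymatroid_function_base[OF assms(1) f1] by blast
  obtain b where b: "\<And>y. y \<in> S2 \<Longrightarrow> 0 \<le> b y" "sum b S2 = \<phi>2 S2"
    "\<And>Y. Y \<subseteq> S2 \<Longrightarrow> sum b Y \<le> \<phi>2 Y" "integer_valued_on S2 \<phi>2 \<Longrightarrow> \<forall>y\<in>S2. b y \<in> \<int>"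
    using polymatroid_function_base[OF assms(2) f2] by blast
  have a_le: "a x \<le> \<phi>1 {x}" if "x \<in> S1" for x using a(3)[of "{x}"] that by simp
  have b_le: "b y \<le> \<phi>2 {y}" if "y \<in> S2" for y using b(3)[of "{y}"] that by simp
  define E where "E = S1 \<times> S2"
  define \<mu> where "\<mu> Z = (\<Sum>y\<in>S2. b y * \<phi>1 (Z\<inverse> `` {y}))" for Z :: "('a \<times> 'b) set"
  define \<nu> where "\<nu> Z = (\<Sum>x\<in>S1. a x * \<phi>2 (Z `` {x}))" for Z :: "('a \<times> 'b) set"
  define ab where "ab = (\<lambda>(x, y). a x * b y)"
  define \<psi> where "\<psi> Z = \<mu> Z + \<nu> Z - sum ab Z" for Z
  define c where "c = (\<lambda>(x, y). \<phi>1 {x} * \<phi>2 {y})"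
  let ?\<phi> = "modular_convolution E \<psi> c"
  have finite_E: "finite E" using assms by (simp add: E_def)
  have sections: "Z `` {x} \<subseteq> S2" "Z\<inverse> `` {y} \<subseteq> S1" if "Z \<subseteq> E" for Z x y
    using that by (auto simp: E_def)
  have c_nonneg: "0 \<le> c e" if "e \<in> E" for e
    using that by (auto simp: E_def c_def intro!: mult_nonneg_nonneg nonneg1 nonneg2)
  have ab_le_\<nu>: "sum ab Z \<le> \<nu> Z" if Z: "Z \<subseteq> E" for Z
    using Z[unfolded E_def]
    by (auto simp: sum_Image[OF assms(1,2)] \<nu>_def ab_def simp flip: sum_distrib_left
        intro!: sum_mono mult_left_mono a(1) b(3))
  have ab_le_\<mu>: "sum ab Z \<le> \<mu> Z" if Z: "Z \<subseteq> E" for Z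
  proof -
    have "sum ab Z = (\<Sum>y\<in>S2. b y * sum a (Z\<inverse> `` {y}))"
      using Z[unfolded E_def]
      by (subst sum_converse_Image[OF assms(1,2)]) (auto simp: ab_def sum_distrib_left mult.commute)
    also have "\<dots> \<le> \<mu> Z"
      unfolding \<mu>_def using sections[OF Z] by (intro sum_mono mult_left_mono a(3) b(1)) auto
    finally show ?thesis .
  qed
  have \<mu>_le: "\<mu> Z \<le> \<psi> Z" and \<nu>_le: "\<nu> Z \<le> \<psi> Z" if "Z \<subseteq> E" for Z
    using ab_le_\<mu>[OF that] ab_le_\<nu>[OF that] by (auto simp: \<psi>_def)
  have \<psi>_nonneg: "0 \<le> \<psi> Z" if Z: "Z \<subseteq> E" for Z
  proof -
    have "0 \<le> \<mu> Z" unfolding \<mu>_def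
      using sections[OF Z] by (intro sum_nonneg mult_nonneg_nonneg b(1) nonneg1) auto
    then show ?thesis using \<mu>_le[OF Z] by linarith
  qed
  have \<psi>_submod: "\<psi> (Z \<inter> W) + \<psi> (Z \<union> W) \<le> \<psi> Z + \<psi> W" if Z: "Z \<subseteq> E" and W: "W \<subseteq> E" for Z W
  proof -
    \<comment> \<open>The subtracted term is modular, so only the submodularity of
      \<open>\<mu>\<close> and \<open>\<nu>\<close> matters; both follow section by section.\<close>
    have "sum ab (Z \<union> W) + sum ab (Z \<inter> W) = sum ab Z + sum ab W"
      using Z W finite_E by (intro sum.union_inter) (auto intro: finite_subset)
    moreover have "(Z \<inter> W) `` {x} = Z `` {x} \<inter> W `` {x}" for x by auto
    moreover have "(Z \<inter> W)\<inverse> `` {y} = Z\<inverse> `` {y} \<inter> W\<inverse> `` {y}" for y by auto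
    moreover have "(Z \<union> W) `` {x} = Z `` {x} \<union> W `` {x}" for x by auto
    moreover have "(Z \<union> W)\<inverse> `` {y} = Z\<inverse> `` {y} \<union> W\<inverse> `` {y}" for y by auto
    moreover note
      weighted_sections_submodular[where w = b and T = S2 and Z = "\<lambda>y. Z\<inverse> `` {y}"
        and W = "\<lambda>y. W\<inverse> `` {y}", OF f1 b(1) sections(2)[OF Z] sections(2)[OF W]]
      weighted_sections_submodular[where w = a and T = S1 and Z = "\<lambda>x. Z `` {x}"
        and W = "\<lambda>x. W `` {x}", OF f2 a(1) sections(1)[OF Z] sections(1)[OF W]]
    ultimately show ?thesis by (simp add: \<psi>_def \<mu>_def \<nu>_def)
  qed
  have marginal1: "?\<phi> (X \<times> S2) = \<phi>1 X * \<phi>2 S2" if X: "X \<subseteq> S1" for X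
  proof -
    \<comment> \<open>On \<open>X \<times> S2\<close> the terms \<open>\<nu>\<close> and
      \<open>sum ab\<close> agree because \<open>b\<close> is tight on \<open>S2\<close>; they
      cancel in \<open>\<psi>\<close> and leave \<open>\<mu>\<close>.\<close>
    have ab: "sum ab (X \<times> S2) = sum a X * \<phi>2 S2"
      by (simp add: ab_def sum_product b(2)[symmetric] flip: sum.cartesian_product)
    have \<mu>: "\<mu> (X \<times> S2) = \<phi>1 X * \<phi>2 S2"
    proof -
      have "\<mu> (X \<times> S2) = (\<Sum>y\<in>S2. \<phi>1 X * b y)"
        unfolding \<mu>_def by (intro sum.cong) (auto simp: Image_def)
      then show ?thesis by (simp add: b(2) flip: sum_distrib_left)
    qed
    have \<nu>: "\<nu> (X \<times> S2) = sum a X * \<phi>2 S2"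
    proof -
      have "\<nu> (X \<times> S2) = (\<Sum>x\<in>S1. if x \<in> X then a x * \<phi>2 S2 else 0)"
        unfolding \<nu>_def by (intro sum.cong) (auto simp: Image_def empty)
      also have "\<dots> = (\<Sum>x\<in>X. a x * \<phi>2 S2)"
        using X assms(1) by (simp add: sum.If_cases Int_absorb1)
      finally show ?thesis by (simp add: sum_distrib_right)
    qed
    have val: "\<psi> (X \<times> S2) = \<phi>1 X * \<phi>2 S2" by (simp add: \<psi>_def ab \<mu> \<nu>)
    \<comment> \<open>No \<open>Z\<close> beats the rectangle itself: \<open>\<psi> Z\<close> is
      bounded below by \<open>\<mu> Z\<close>, and the section bound applies with weights
      \<open>b y\<close> below \<open>\<phi>2 {y}\<close>.\<close>
    have "\<psi> (X \<times> S2) \<le> \<psi> Z + sum c (X \<times> S2 - Z)" if Z: "Z \<subseteq> E" for Z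
    proof -
      have "sum c (X \<times> S2 - Z) = (\<Sum>y\<in>S2. \<Sum>x\<in>X - Z\<inverse> `` {y}. \<phi>1 {x} * \<phi>2 {y})"
        using X by (subst sum_converse_Image[OF assms(1,2)])
          (auto simp: c_def intro!: sum.cong)
      then show ?thesis
        using weighted_sections_lower_bound[where w = b and T = S2 and Z = "\<lambda>y. Z\<inverse> `` {y}"
            and d = "\<lambda>y. \<phi>2 {y}", OF f1 X sections(2)[OF Z] b(1) b_le] \<mu>_le[OF Z]
        by (simp add: val b(2) \<mu>_def)
    qed
    then show ?thesis
      using modular_convolution_eqI[OF finite_E, of "X \<times> S2" \<psi> c] X val by (auto simp: E_def)
  qed
  \<comment> \<open>The same argument with the roles exchanged: now \<open>\<mu>\<close> cancels
    against \<open>sum ab\<close>, and \<open>\<nu>\<close> supplies both the value and the lower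
    bound.\<close>
  have marginal2: "?\<phi> (S1 \<times> Y) = \<phi>1 S1 * \<phi>2 Y" if Y: "Y \<subseteq> S2" for Y
  proof -
    have ab: "sum ab (S1 \<times> Y) = \<phi>1 S1 * sum b Y"
      by (simp add: ab_def sum_product a(2)[symmetric] flip: sum.cartesian_product)
    have \<nu>: "\<nu> (S1 \<times> Y) = \<phi>1 S1 * \<phi>2 Y"
    proof -
      have "\<nu> (S1 \<times> Y) = (\<Sum>x\<in>S1. a x * \<phi>2 Y)"
        unfolding \<nu>_def by (intro sum.cong) (auto simp: Image_def)
      then show ?thesis by (simp add: a(2) flip: sum_distrib_right)
    qed
    have \<mu>: "\<mu> (S1 \<times> Y) = \<phi>1 S1 * sum b Y"
    proof -
      have "\<mu> (S1 \<times> Y) = (\<Sum>y\<in>S2. if y \<in> Y then \<phi>1 S1 * b y else 0)"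
        unfolding \<mu>_def by (intro sum.cong) (auto simp: Image_def empty)
      also have "\<dots> = (\<Sum>y\<in>Y. \<phi>1 S1 * b y)"
        using Y assms(2) by (simp add: sum.If_cases Int_absorb1)
      finally show ?thesis by (simp add: sum_distrib_left)
    qed
    have val: "\<psi> (S1 \<times> Y) = \<phi>1 S1 * \<phi>2 Y" by (simp add: \<psi>_def ab \<mu> \<nu>)
    have "\<psi> (S1 \<times> Y) \<le> \<psi> Z + sum c (S1 \<times> Y - Z)" if Z: "Z \<subseteq> E" for Z
    proof -
      have "sum c (S1 \<times> Y - Z) = (\<Sum>x\<in>S1. \<Sum>y\<in>Y - Z `` {x}. \<phi>2 {y} * \<phi>1 {x})"
        using Y by (subst sum_Image[OF assms(1,2)])
          (auto simp: c_def intro!: sum.cong)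
      then show ?thesis
        using weighted_sections_lower_bound[where w = a and T = S1 and Z = "\<lambda>x. Z `` {x}"
            and d = "\<lambda>x. \<phi>1 {x}", OF f2 Y sections(1)[OF Z] a(1) a_le] \<nu>_le[OF Z]
        by (simp add: val a(2) \<nu>_def mult.commute[of "\<phi>1 S1"])
    qed
    then show ?thesis
      using modular_convolution_eqI[OF finite_E, of "S1 \<times> Y" \<psi> c] Y val by (auto simp: E_def)
  qed
  have \<psi>_empty: "\<psi> {} = 0" by (simp add: \<psi>_def \<mu>_def \<nu>_def empty)
  have bound: "?\<phi> X \<le> k1 * k2 * real (card X)" if X: "X \<subseteq> E" for X
  proof -
    have "c e \<le> k1 * k2" if e: "e \<in> E" for e
    proof -
      obtain x y where xy: "e = (x, y)" "x \<in> S1" "y \<in> S2" using e by (auto simp: E_def)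
      have "\<phi>1 {x} \<le> k1" "\<phi>2 {y} \<le> k2" using le1[of "{x}"] le2[of "{y}"] xy by auto
      then show ?thesis
        using xy nonneg2[of "{y}"] assms(3) by (auto simp: c_def intro!: mult_mono)
    qed
    then have "sum c X \<le> real (card X) * (k1 * k2)" using X by (intro sum_bounded_above) auto
    \<comment> \<open>The candidate \<open>Z = {}\<close> in the minimum costs exactly
      \<open>sum c X\<close>.\<close>
    then show ?thesis
      using modular_convolution_le[OF finite_E, of "{}" \<psi> c X] by (simp add: \<psi>_empty mult.commute)
  qed
  have "integer_valued_on E ?\<phi>"
    if int: "integer_valued_on S1 \<phi>1" "integer_valued_on S2 \<phi>2"
  proof -
    have ints: "X \<subseteq> S1 \<Longrightarrow> \<phi>1 X \<in> \<int>" "Y \<subseteq> S2 \<Longrightarrow> \<phi>2 Y \<in> \<int>"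
        "x \<in> S1 \<Longrightarrow> a x \<in> \<int>" "y \<in> S2 \<Longrightarrow> b y \<in> \<int>" for X Y x y
      using int a(4) b(4) unfolding integer_valued_on_def by auto
    have "?\<phi> X \<in> \<int>" if X: "X \<subseteq> E" for X
    proof -
      \<comment> \<open>The minimum is attained, so its value is built from integers by finite sums,
        products and one subtraction.\<close>
      obtain Z where Z: "Z \<subseteq> E" "?\<phi> X = \<psi> Z + sum c (X - Z)"
        by (rule modular_convolution_attained[OF finite_E])
      have "\<mu> Z \<in> \<int>" "\<nu> Z \<in> \<int>"
        unfolding \<mu>_def \<nu>_def using sections[OF Z(1)] by (intro Ints_sum Ints_mult ints; simp)+
      moreover have "sum ab Z \<in> \<int>" "sum c (X - Z) \<in> \<int>"
        using X Z(1) by (auto simp: ab_def c_def E_def intro!: Ints_sum Ints_mult ints)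
      ultimately show ?thesis using Z(2) by (simp add: \<psi>_def)
    qed
    then show ?thesis by (simp add: integer_valued_on_def)
  qed
  moreover have "polymatroid_function E ?\<phi>"
    by (rule modular_convolution_polymatroid_function[OF finite_E c_nonneg \<psi>_empty \<psi>_nonneg \<psi>_submod])
  ultimately show ?thesis
    using marginal1 marginal2 bound
    unfolding is_coupling_def k_polymatroid_function_def E_def by blast
qed

end
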